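(* For the standard R. Thompson groups $F<T$, the subgroup $F$ is normalish in $T$.
   Context: Let $S^1=\mathbb{R}/\mathbb{Z}$. R. Thompson's group $T$ is the group of all orientation-preserving piecewise-linear homeomorphisms of $S^1$ which preserve the set of dyadic rationals $\{a/2^k \mid a,k\in\mathbb{Z}\}$ (taken modulo $\mathbb{Z}$), which admit at most finitely many breaks in slope, all occurring at dyadic rationals, and all of whose affine components have slopes that are integral powers of $2$. The standard copy of R. Thompson's group $F$ in $T$ is the subgroup of $T$ consisting of the elements that fix the point $0\in S^1$ under the natural action of $T$ on $S^1$. Normalish: a subgroup $M$ of a group $G$ is normalish in $G$ if and only if for every finite (nonempty) set $K=\{k_1,k_2,\ldots,k_m\}\subset G$ we have $\bigcap_{i=1}^m M^{k_i}\neq\{1_G\}$, where $M^{k}=k^{-1}Mk$. *)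

theory Defs
  imports "HOL-Analysis.Analysis" "HOL-Algebra.Coset"
begin

section \<open>The circle \<open>\<real>/\<int>\<close>\<close>

quotient_type circle = real / "\<lambda>x y::real. x - y \<in> \<int>"
  morphisms circle_rep circle_proj
proof (rule equivpI)
  show "reflp (\<lambda>x y::real. x - y \<in> \<int>)"
    by (rule reflpI) simp
  show "symp (\<lambda>x y::real. x - y \<in> \<int>)"
  proof (rule sympI)
    fix x y :: real assume "x - y \<in> \<int>"
    then have "- (x - y) \<in> \<int>" by (rule Ints_minus)
    then show "y - x \<in> \<int>" by simp
  qed
  show "transp (\<lambda>x y::real. x - y \<in> \<int>)"
  proof (rule transpI)
    fix x y z :: real assume "x - y \<in> \<int>" "y - z \<in> \<int>"
    then have "(x - y) + (y - z) \<in> \<int>" by (rule Ints_add)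
    then show "x - z \<in> \<int>" by simp
  qed
qed

lemma circle_proj_eq_iff: "circle_proj x = circle_proj y \<longleftrightarrow> x - y \<in> \<int>"
  by (rule circle.abs_eq_iff)

text \<open>The circle carries the quotient topology.\<close>

instantiation circle :: topological_space
begin

definition open_circle :: "circle set \<Rightarrow> bool" where
  "open_circle U \<longleftrightarrow> open (circle_proj -` U)"

instance
proof
  show "open (UNIV :: circle set)"
    by (simp add: open_circle_def)
  show "open (U \<inter> V)" if "open U" "open V" for U V :: "circle set"
    using that by (simp add: open_circle_def vimage_Int open_Int)
  show "open (\<Union>K)" if "\<forall>U\<in>K. open U" for K :: "circle set set"
    using that by (auto simp add: open_circle_def vimage_Union intro!: open_UN)
qed

end

definition circle_dyadics :: "circle set" where
  "circle_dyadics = {circle_proj (of_int a / 2 powi k) | (a::int) (k::int). True}"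

definition circle_homeo :: "(circle \<Rightarrow> circle) \<Rightarrow> bool" where
  "circle_homeo f \<longleftrightarrow> (\<exists>g. homeomorphism UNIV UNIV f g)"

text \<open>A circle homeomorphism preserves orientation iff it lifts to an increasing map of \<open>\<real>\<close>.\<close>

definition orientation_preserving :: "(circle \<Rightarrow> circle) \<Rightarrow> bool" where
  "orientation_preserving f \<longleftrightarrow>
     (\<exists>h::real \<Rightarrow> real. continuous_on UNIV h \<and> strict_mono h \<and>
        (\<forall>x. circle_proj (h x) = f (circle_proj x)))"

text \<open>Near \<open>p\<close>, in the local coordinates given by the projection \<open>\<real> \<rightarrow> \<real>/\<int>\<close>, the map \<open>f\<close> is
  affine with slope \<open>s\<close>.\<close>

definition locally_affine_at :: "(circle \<Rightarrow> circle) \<Rightarrow> circle \<Rightarrow> real \<Rightarrow> bool" where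
  "locally_affine_at f p s \<longleftrightarrow>
     (\<exists>x y. circle_proj x = p \<and>
        (\<exists>\<epsilon>>0. \<forall>t. \<bar>t\<bar> < \<epsilon> \<longrightarrow> f (circle_proj (x + t)) = circle_proj (y + s * t)))"

definition breaks :: "(circle \<Rightarrow> circle) \<Rightarrow> circle set" where
  "breaks f = {p. \<nexists>s. locally_affine_at f p s}"


section \<open>Thompson's groups \<open>T\<close> and \<open>F\<close>\<close>

text \<open>Finiteness of the set of breaks makes the homeomorphism piecewise linear.\<close>

definition thompson_T :: "(circle \<Rightarrow> circle) monoid" where
  "thompson_T =
     \<lparr> carrier = {f. circle_homeo f \<and> orientation_preserving f \<and>
                    f ` circle_dyadics = circle_dyadics \<and>
                    finite (breaks f) \<and> breaks f \<subseteq> circle_dyadics \<and>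
                    (\<forall>p s. locally_affine_at f p s \<longrightarrow> (\<exists>k::int. s = 2 powi k))},
       mult = (\<circ>),
       one = id \<rparr>"

definition thompson_F :: "(circle \<Rightarrow> circle) set" where
  "thompson_F = {f \<in> carrier thompson_T. f (circle_proj 0) = circle_proj 0}"


section \<open>Normalish subgroups\<close>

definition conjugate :: "('a, 'b) monoid_scheme \<Rightarrow> 'a set \<Rightarrow> 'a \<Rightarrow> 'a set" where
  "conjugate G M k = (inv\<^bsub>G\<^esub> k <#\<^bsub>G\<^esub> M) #>\<^bsub>G\<^esub> k"

definition normalish :: "'a set \<Rightarrow> ('a, 'b) monoid_scheme \<Rightarrow> bool" where
  "normalish M G \<longleftrightarrow> group G \<and> subgroup M G \<and>
     (\<forall>K. finite K \<and> K \<noteq> {} \<and> K \<subseteq> carrier G \<longrightarrow> (\<Inter>k\<in>K. conjugate G M k) \<noteq> {\<one>\<^bsub>G\<^esub>})"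

end

theory Submission imports Defs begin

text \<open>The conjugate \<open>k\<^sup>-\<^sup>1 F k\<close> is the stabiliser in \<open>T\<close> of the point \<open>k\<^sup>-\<^sup>1(0)\<close>, so an intersection
  of finitely many conjugates is the pointwise stabiliser of a finite set.  A finite set misses
  some interval \<open>(0, 2\<^sup>-\<^sup>n)\<close>, and a rescaled copy of a standard generator of \<open>F\<close> supported on the
  closure of that interval is a nontrivial element of this stabiliser.\<close>

section \<open>Slopes of circle maps\<close>

lemma circle_proj_surj: "\<exists>x. circle_proj x = p"
  using Quotient_abs_rep[OF Quotient_circle] by blast

lemma circle_proj_add_cong: "circle_proj x = circle_proj y \<Longrightarrow> circle_proj (x + t) = circle_proj (y + t)"
  by (simp add: circle_proj_eq_iff)

text \<open>The definition offers some representative of the point. Two representatives differ by an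
  integer, which the projection absorbs, so the expansion can be taken around any prescribed
  one.\<close>

lemma locally_affine_atE:
  assumes "locally_affine_at f (circle_proj x) s"
  obtains y e where "e > 0" "\<And>t. \<bar>t\<bar> < e \<Longrightarrow> f (circle_proj (x + t)) = circle_proj (y + s * t)"
proof -
  obtain x' y e where x': "circle_proj x' = circle_proj x" and e: "e > 0"
    and *: "\<forall>t. \<bar>t\<bar> < e \<longrightarrow> f (circle_proj (x' + t)) = circle_proj (y + s * t)"
    using assms unfolding locally_affine_at_def by blast
  have "f (circle_proj (x + t)) = circle_proj (y + s * t)" if "\<bar>t\<bar> < e" for t
    using * circle_proj_add_cong[OF x', of t] that by metis
  then show ?thesis using that e by blast
qed

text \<open>Chain rule: the inner affine expression is substituted into the outer one on a
  neighbourhood small enough for both to be valid.\<close>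

lemma locally_affine_at_comp:
  assumes g: "locally_affine_at g p s" and f: "locally_affine_at f (g p) r"
  shows "locally_affine_at (f \<circ> g) p (r * s)"
proof -
  obtain x where x: "p = circle_proj x" using circle_proj_surj by metis
  obtain y e where e: "e > 0" and gx: "\<And>t. \<bar>t\<bar> < e \<Longrightarrow> g (circle_proj (x + t)) = circle_proj (y + s * t)"
    using g unfolding x by (elim locally_affine_atE) blast
  have "g p = circle_proj y" using gx[of 0] e x by simp
  then obtain z e' where e': "e' > 0" and fy: "\<And>t. \<bar>t\<bar> < e' \<Longrightarrow> f (circle_proj (y + t)) = circle_proj (z + r * t)"
    using f by (metis locally_affine_atE)
  \<comment> \<open>The summand 1 keeps the denominator positive when \<open>s = 0\<close>, and the
    bound still forces \<open>\<bar>s * t\<bar> < e'\<close>.\<close>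
  define \<delta> where "\<delta> = min e (e' / (\<bar>s\<bar> + 1))"
  have "\<delta> > 0" using e e' by (simp add: \<delta>_def)
  moreover have "(f \<circ> g) (circle_proj (x + t)) = circle_proj (z + r * s * t)" if t: "\<bar>t\<bar> < \<delta>" for t
  proof -
    have "\<bar>t\<bar> * (\<bar>s\<bar> + 1) < e'" using t by (simp add: \<delta>_def pos_less_divide_eq)
    then have "\<bar>s * t\<bar> < e'" by (simp add: abs_mult algebra_simps)
    then show ?thesis using gx[of t] fy[of "s * t"] t by (simp add: \<delta>_def mult.assoc)
  qed
  ultimately show ?thesis unfolding locally_affine_at_def x by blast
qed

text \<open>A nonzero \<open>c\<close> has small multiples of absolute value strictly between 0 and
  1. This turns congruences modulo the integers into equalities of slopes.\<close>

lemma real_eq_0_if_small_multiples_Ints: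
  fixes c :: real
  assumes "e > 0" and int: "\<And>t. \<bar>t\<bar> < e \<Longrightarrow> c * t \<in> \<int>"
  shows "c = 0"
proof (rule ccontr)
  assume c: "c \<noteq> 0"
  \<comment> \<open>With this choice \<open>c * t\<close> is nonzero and has absolute value at most
    1/2.\<close>
  define t where "t = min (e / 2) (1 / (2 * \<bar>c\<bar>))"
  have t: "t > 0" "t < e" using assms(1) c by (auto simp: t_def)
  have "\<bar>c\<bar> * t \<le> \<bar>c\<bar> * (1 / (2 * \<bar>c\<bar>))" by (intro mult_left_mono) (auto simp: t_def)
  then have "\<bar>c * t\<bar> < 1" using c t by (simp add: abs_mult)
  moreover have "c * t \<in> \<int>" using int t by simp
  ultimately have "c * t = 0" using Ints_nonzero_abs_less1 by blast
  then show False using c t by simp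
qed

text \<open>Two affine expressions for the same map differ by integers near the point. Subtracting
  the difference at \<open>t = 0\<close> cancels the constants and leaves \<open>(s - r) * t\<close>
  integral for all small \<open>t\<close>.\<close>

lemma locally_affine_at_unique:
  assumes "locally_affine_at f p s" "locally_affine_at f p r"
  shows "s = r"
proof -
  obtain x where x: "p = circle_proj x" using circle_proj_surj by metis
  obtain y e where e: "e > 0" and y: "\<And>t. \<bar>t\<bar> < e \<Longrightarrow> f (circle_proj (x + t)) = circle_proj (y + s * t)"
    using assms(1) unfolding x by (elim locally_affine_atE) blast
  obtain z e' where e': "e' > 0" and z: "\<And>t. \<bar>t\<bar> < e' \<Longrightarrow> f (circle_proj (x + t)) = circle_proj (z + r * t)"
    using assms(2) unfolding x by (elim locally_affine_atE) blast
  have *: "(y + s * t) - (z + r * t) \<in> \<int>" if "\<bar>t\<bar> < min e e'" for t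
    using y[of t] z[of t] that by (simp flip: circle_proj_eq_iff)
  have int: "(s - r) * t \<in> \<int>" if "\<bar>t\<bar> < min e e'" for t
    using Ints_diff[OF *[OF that] *[of 0]] e e' by (simp add: algebra_simps)
  have "s - r = 0"
    using e e' by (intro real_eq_0_if_small_multiples_Ints[OF _ int, of "min e e'"]) simp_all
  then show ?thesis by simp
qed

text \<open>Being affine at a point means being affine on an arc with the same slope at each of its
  points, and an arc is infinite.\<close>

lemma locally_affine_at_nearby:
  assumes "locally_affine_at f p s" and fin: "finite B"
  shows "\<exists>q. q \<notin> B \<and> locally_affine_at f q s"
proof -
  obtain x where x: "p = circle_proj x" using circle_proj_surj by metis
  obtain y e where e: "e > 0" and y: "\<And>t. \<bar>t\<bar> < e \<Longrightarrow> f (circle_proj (x + t)) = circle_proj (y + s * t)"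
    using assms(1) unfolding x by (elim locally_affine_atE) blast
  have aff: "locally_affine_at f (circle_proj (x + u)) s" if u: "\<bar>u\<bar> < e" for u
  proof -
    have "f (circle_proj ((x + u) + t)) = circle_proj ((y + s * u) + s * t)" if "\<bar>t\<bar> < e - \<bar>u\<bar>" for t
      using y[of "u + t"] that by (simp add: algebra_simps)
    moreover have "e - \<bar>u\<bar> > 0" using u by simp
    ultimately show ?thesis unfolding locally_affine_at_def by blast
  qed
  \<comment> \<open>Length at most 1 makes the projection injective on the open interval, so its
    image is infinite.\<close>
  define I where "I = {0<..<min e 1}"
  have "inj_on (\<lambda>u. circle_proj (x + u)) I"
  proof (rule inj_onI)
    fix u v assume uv: "u \<in> I" "v \<in> I" "circle_proj (x + u) = circle_proj (x + v)"
    then have "u - v \<in> \<int>" by (simp add: circle_proj_eq_iff)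
    moreover have "\<bar>u - v\<bar> < 1" using uv by (auto simp: I_def)
    ultimately have "u - v = 0" by (rule Ints_nonzero_abs_less1)
    then show "u = v" by simp
  qed
  moreover have "infinite I" using e by (simp add: I_def)
  ultimately have "infinite ((\<lambda>u. circle_proj (x + u)) ` I)" using finite_image_iff by blast
  then obtain u where "u \<in> I" "circle_proj (x + u) \<notin> B"
    using fin by (meson finite_subset image_subsetI)
  then show ?thesis using aff[of u] by (auto simp: I_def)
qed

text \<open>The affine expression can be solved for \<open>t\<close> once \<open>s\<close> is
  nonzero; slope 0 would make \<open>f\<close> constant on an arc, against injectivity.\<close>

lemma locally_affine_at_inv:
  assumes f: "bij f" and aff: "locally_affine_at f p s"
  shows "s \<noteq> 0 \<and> locally_affine_at (inv_into UNIV f) (f p) (1 / s)"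
proof -
  obtain x where x: "p = circle_proj x" using circle_proj_surj by metis
  obtain y e where e: "e > 0" and y: "\<And>t. \<bar>t\<bar> < e \<Longrightarrow> f (circle_proj (x + t)) = circle_proj (y + s * t)"
    using aff unfolding x by (elim locally_affine_atE) blast
  have s: "s \<noteq> 0"
  proof
    assume "s = 0"
    then have "f (circle_proj (x + t)) = f (circle_proj x)" if "\<bar>t\<bar> < e" for t
      using y[OF that] y[of 0] e by simp
    then have "circle_proj (x + t) = circle_proj x" if "\<bar>t\<bar> < e" for t
      using f that by (meson bij_is_inj injD)
    then have "1 * t \<in> \<int>" if "\<bar>t\<bar> < e" for t using that by (simp add: circle_proj_eq_iff)
    then show False using real_eq_0_if_small_multiples_Ints[OF e, of 1] by simp
  qed
  have "inv_into UNIV f (circle_proj (y + u)) = circle_proj (x + (1 / s) * u)" if u: "\<bar>u\<bar> < e * \<bar>s\<bar>" for u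
  proof -
    have "\<bar>u / s\<bar> < e" using u s by (simp add: pos_divide_less_eq)
    then have "f (circle_proj (x + u / s)) = circle_proj (y + u)" using y[of "u / s"] s by simp
    then show ?thesis using f by (simp add: bij_is_inj inv_f_eq)
  qed
  moreover have "e * \<bar>s\<bar> > 0" using e s by simp
  moreover have "f p = circle_proj y" using y[of 0] e x by simp
  ultimately show ?thesis using s unfolding locally_affine_at_def by metis
qed


section \<open>Thompson's group \<open>T\<close> is a group\<close>

text \<open>Here \<open>B\<close> only has to contain the breaks. \<open>f\<close> may still be
  affine at points of \<open>B\<close>, but such a slope recurs at a nearby point outside
  \<open>B\<close>, where uniqueness of slopes makes it a power of 2.\<close>

lemma thompson_T_I:
  assumes "circle_homeo f" "orientation_preserving f" "f ` circle_dyadics = circle_dyadics"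
    and B: "finite B" "B \<subseteq> circle_dyadics"
    and aff: "\<And>p. p \<notin> B \<Longrightarrow> \<exists>k::int. locally_affine_at f p (2 powi k)"
  shows "f \<in> carrier thompson_T"
proof -
  have sub: "breaks f \<subseteq> B" using aff by (auto simp: breaks_def)
  have "\<exists>k::int. s = 2 powi k" if "locally_affine_at f p s" for p s
    using locally_affine_at_nearby[OF that B(1)] aff locally_affine_at_unique by metis
  then show ?thesis
    using assms sub finite_subset by (auto simp: thompson_T_def)
qed

lemma thompson_T_D:
  assumes "f \<in> carrier thompson_T"
  shows "circle_homeo f" "orientation_preserving f" "f ` circle_dyadics = circle_dyadics"
    "finite (breaks f)" "breaks f \<subseteq> circle_dyadics"
    and "\<And>p. p \<notin> breaks f \<Longrightarrow> \<exists>k::int. locally_affine_at f p (2 powi k)"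
proof -
  show "\<exists>k::int. locally_affine_at f p (2 powi k)" if "p \<notin> breaks f" for p
    using that assms by (fastforce simp: breaks_def thompson_T_def)
qed (use assms in \<open>auto simp: thompson_T_def\<close>)

lemma circle_homeo_bij: "circle_homeo f \<Longrightarrow> bij f"
  unfolding circle_homeo_def homeomorphism_def by (metis UNIV_I bij_iff)

lemma circle_homeo_inv:
  assumes "circle_homeo f" shows "circle_homeo (inv_into UNIV f)"
proof -
  obtain g where g: "homeomorphism UNIV UNIV f g" using assms unfolding circle_homeo_def by blast
  then have "inv_into UNIV f = g"
    by (metis (no_types, lifting) UNIV_I homeomorphism_def inv_equality)
  then show ?thesis using g homeomorphism_symD unfolding circle_homeo_def by blast
qed

text \<open>The inverse of a lift of \<open>f\<close> is a lift of the inverse of \<open>f\<close>.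
  The work lies in showing that a lift is onto the line.\<close>

lemma orientation_preserving_inv:
  assumes "bij f" "orientation_preserving f"
  shows "orientation_preserving (inv_into UNIV f)"
proof -
  obtain h where cont: "continuous_on UNIV h" and mono: "strict_mono h"
    and lift: "\<And>x. circle_proj (h x) = f (circle_proj x)"
    using assms(2) unfolding orientation_preserving_def by blast
  \<comment> \<open>The increment over one period is an integer because \<open>h\<close> lifts a
    circle map, and positive because \<open>h\<close> increases, hence at least 1.\<close>
  have step: "h (x + 1) \<ge> h x + 1" for x
  proof -
    have "circle_proj (x + 1) = circle_proj x" by (simp add: circle_proj_eq_iff)
    then have "h (x + 1) - h x \<in> \<int>" by (metis lift circle_proj_eq_iff)
    moreover have "h x < h (x + 1)" using mono by (simp add: strict_mono_def)
    ultimately show ?thesis using Ints_nonzero_abs_less1[of "h (x + 1) - h x"] by linarith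
  qed
  have up: "h (real n) \<ge> h 0 + n" for n
  proof (induction n)
    case (Suc n) then show ?case using step[of "real n"] by (simp add: add.commute)
  qed simp
  have down: "h (- real n) \<le> h 0 - n" for n
  proof (induction n)
    case (Suc n) then show ?case using step[of "- real (Suc n)"] by simp
  qed simp
  \<comment> \<open>By \<open>up\<close> and \<open>down\<close> the lift is unbounded in both
    directions, so the intermediate value theorem reaches every \<open>y\<close>.\<close>
  have "surj h"
    unfolding surj_def
  proof
    fix y :: real
    obtain n where n: "real n \<ge> \<bar>y - h 0\<bar>" using real_arch_simple by blast
    have "\<exists>x\<ge>- real n. x \<le> real n \<and> h x = y"
      using up[of n] down[of n] n cont
      by (intro IVT') (auto intro: continuous_on_subset)
    then show "\<exists>x. y = h x" by blast
  qed
  have inj: "inj h" using mono strict_mono_imp_inj_on by blast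
  have invm: "strict_mono (inv_into UNIV h)"
  proof (rule strict_monoI)
    fix x y :: real assume "x < y"
    then have "h (inv_into UNIV h x) < h (inv_into UNIV h y)"
      using \<open>surj h\<close> by (simp add: surj_f_inv_f)
    then show "inv_into UNIV h x < inv_into UNIV h y" using mono by (simp add: strict_mono_less)
  qed
  \<comment> \<open>A monotone map with open image is continuous; the image is the whole line
    here.\<close>
  moreover have "continuous_on UNIV (inv_into UNIV h)"
    using invm inj by (intro continuous_onI_mono) (auto simp: inj_imp_surj_inv strict_mono_less_eq)
  moreover have "circle_proj (inv_into UNIV h y) = inv_into UNIV f (circle_proj y)" for y
    using lift[of "inv_into UNIV h y"] assms(1) \<open>surj h\<close> by (simp add: surj_f_inv_f bij_is_inj inv_f_eq)
  ultimately show ?thesis unfolding orientation_preserving_def by blast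
qed

lemma thompson_T_id: "id \<in> carrier thompson_T"
proof (rule thompson_T_I[where B="{}"])
  show "circle_homeo id"
    unfolding circle_homeo_def by (intro exI[of _ id]) (simp add: homeomorphism_def)
  show "orientation_preserving id"
    unfolding orientation_preserving_def
    by (intro exI[of _ id]) (simp add: strict_mono_def)
  have "locally_affine_at id p 1" for p
    unfolding locally_affine_at_def
    using circle_proj_surj[of p] by (metis id_apply mult_1 zero_less_one)
  then have "locally_affine_at id p (2 powi 0)" for p by simp
  then show "\<exists>k::int. locally_affine_at id p (2 powi k)" for p by blast
qed auto

text \<open>A break of the composite is a break of \<open>g\<close> or is sent by \<open>g\<close>
  to a break of \<open>f\<close>; elsewhere the chain rule multiplies powers of 2.\<close>

lemma thompson_T_comp:
  assumes f: "f \<in> carrier thompson_T" and g: "g \<in> carrier thompson_T"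
  shows "f \<circ> g \<in> carrier thompson_T"
proof (rule thompson_T_I[where B="breaks g \<union> g -` breaks f"])
  note f = thompson_T_D[OF f] and g = thompson_T_D[OF g]
  show "circle_homeo (f \<circ> g)"
    using f(1) g(1) homeomorphism_compose unfolding circle_homeo_def by blast
  show "orientation_preserving (f \<circ> g)"
  proof -
    obtain h where h: "continuous_on UNIV h" "strict_mono h" "\<And>x. circle_proj (h x) = f (circle_proj x)"
      using f(2) unfolding orientation_preserving_def by blast
    obtain h' where h': "continuous_on UNIV h'" "strict_mono h'" "\<And>x. circle_proj (h' x) = g (circle_proj x)"
      using g(2) unfolding orientation_preserving_def by blast
    have "continuous_on UNIV (h \<circ> h')"
      using h h' by (meson continuous_on_compose continuous_on_subset subset_UNIV)
    moreover have "strict_mono (h \<circ> h')" using h h' by (simp add: strict_mono_def)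
    ultimately show ?thesis using h(3) h'(3) unfolding orientation_preserving_def
      by (intro exI[of _ "h \<circ> h'"]) simp
  qed
  show "(f \<circ> g) ` circle_dyadics = circle_dyadics" using f(3) g(3) by (metis image_comp)
  have bij: "bij g" using g(1) by (rule circle_homeo_bij)
  show "finite (breaks g \<union> g -` breaks f)"
    using f(4) g(4) bij by (simp add: bij_is_inj finite_vimageI)
  \<comment> \<open>As a bijection mapping the dyadic points onto themselves, \<open>g\<close> sends
    only dyadic points to dyadic points.\<close>
  have "g -` breaks f \<subseteq> circle_dyadics"
  proof
    fix p assume "p \<in> g -` breaks f"
    then have "g p \<in> g ` circle_dyadics" using f(5) g(3) by auto
    then show "p \<in> circle_dyadics" using bij by (simp add: bij_is_inj inj_image_mem_iff)
  qed
  then show "breaks g \<union> g -` breaks f \<subseteq> circle_dyadics" using g(5) by simp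
  show "\<exists>k::int. locally_affine_at (f \<circ> g) p (2 powi k)" if "p \<notin> breaks g \<union> g -` breaks f" for p
  proof -
    obtain k l :: int where "locally_affine_at g p (2 powi k)" "locally_affine_at f (g p) (2 powi l)"
      using f(6)[of "g p"] g(6)[of p] \<open>p \<notin> _\<close> by blast
    then have "locally_affine_at (f \<circ> g) p (2 powi (l + k))"
      using locally_affine_at_comp by (simp add: power_int_add)
    then show ?thesis by blast
  qed
qed

text \<open>Breaks of the inverse can occur only at images of breaks of \<open>f\<close>; at other
  points the slope is the reciprocal of a power of 2.\<close>

lemma thompson_T_inv:
  assumes f: "f \<in> carrier thompson_T"
  shows "inv_into UNIV f \<in> carrier thompson_T"
proof (rule thompson_T_I[where B="f ` breaks f"])
  note f = thompson_T_D[OF f]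
  have bij: "bij f" using f(1) by (rule circle_homeo_bij)
  show "circle_homeo (inv_into UNIV f)" using f(1) by (rule circle_homeo_inv)
  show "orientation_preserving (inv_into UNIV f)" using bij f(2) by (rule orientation_preserving_inv)
  show "inv_into UNIV f ` circle_dyadics = circle_dyadics"
    using f(3) bij by (metis bij_is_inj image_inv_f_f)
  show "finite (f ` breaks f)" using f(4) by simp
  show "f ` breaks f \<subseteq> circle_dyadics" using f(3,5) by blast
  show "\<exists>k::int. locally_affine_at (inv_into UNIV f) p (2 powi k)" if "p \<notin> f ` breaks f" for p
  proof -
    have p: "f (inv_into UNIV f p) = p" using bij by (simp add: bij_is_surj surj_f_inv_f)
    then have "inv_into UNIV f p \<notin> breaks f" using \<open>p \<notin> _\<close> by force
    then obtain k :: int where "locally_affine_at f (inv_into UNIV f p) (2 powi k)" using f(6) by blast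
    then have "locally_affine_at (inv_into UNIV f) p (1 / 2 powi k)"
      using locally_affine_at_inv[OF bij] p by metis
    then have "locally_affine_at (inv_into UNIV f) p (2 powi (- k))"
      by (simp add: power_int_minus divide_inverse)
    then show ?thesis by blast
  qed
qed

lemma mult_thompson_T [simp]: "f \<otimes>\<^bsub>thompson_T\<^esub> g = f \<circ> g"
  and one_thompson_T [simp]: "\<one>\<^bsub>thompson_T\<^esub> = id"
  by (simp_all add: thompson_T_def)

lemma thompson_T_inv_comp:
  assumes "f \<in> carrier thompson_T" shows "inv_into UNIV f \<circ> f = id"
  using circle_homeo_bij[OF thompson_T_D(1)[OF assms]] by (simp add: bij_is_inj)

lemma group_thompson_T: "group thompson_T"
proof (rule groupI)
  show "\<exists>g\<in>carrier thompson_T. g \<otimes>\<^bsub>thompson_T\<^esub> f = \<one>\<^bsub>thompson_T\<^esub>"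
    if "f \<in> carrier thompson_T" for f
    using thompson_T_inv[OF that] thompson_T_inv_comp[OF that] by (intro bexI) simp_all
qed (simp_all add: thompson_T_id thompson_T_comp o_assoc)

lemma inv_thompson_T:
  assumes "f \<in> carrier thompson_T"
  shows "inv\<^bsub>thompson_T\<^esub> f = inv_into UNIV f"
proof (rule group.inv_equality[OF group_thompson_T])
  show "inv_into UNIV f \<otimes>\<^bsub>thompson_T\<^esub> f = \<one>\<^bsub>thompson_T\<^esub>"
    using thompson_T_inv_comp[OF assms] by simp
qed (use assms thompson_T_inv in blast)+

section \<open>The subgroup F and its conjugates\<close>

lemma subgroup_thompson_F: "subgroup thompson_F thompson_T"
proof (rule group.subgroupI[OF group_thompson_T])
  show "thompson_F \<subseteq> carrier thompson_T" by (auto simp: thompson_F_def)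
  have "id \<in> thompson_F" using thompson_T_id by (simp add: thompson_F_def)
  then show "thompson_F \<noteq> {}" by blast
  show "inv\<^bsub>thompson_T\<^esub> f \<in> thompson_F" if "f \<in> thompson_F" for f
  proof -
    have f: "f \<in> carrier thompson_T" "f (circle_proj 0) = circle_proj 0"
      using that by (simp_all add: thompson_F_def)
    then have "inv_into UNIV f (circle_proj 0) = circle_proj 0"
      using thompson_T_inv_comp[OF f(1)] by (metis comp_apply id_apply)
    then show ?thesis
      using thompson_T_inv[OF f(1)] inv_thompson_T[OF f(1)] by (simp add: thompson_F_def)
  qed
  show "f \<otimes>\<^bsub>thompson_T\<^esub> g \<in> thompson_F" if "f \<in> thompson_F" "g \<in> thompson_F" for f g
    using that thompson_T_comp[of f g] by (simp add: thompson_F_def)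
qed

text \<open>If \<open>f\<close> fixes the preimage of 0 under \<open>k\<close>, then
  \<open>k \<circ> f \<circ> inv_into UNIV k\<close> fixes 0. It therefore lies in F, and
  conjugating it back by \<open>k\<close> returns \<open>f\<close>.\<close>

lemma mem_conjugate_thompson_F:
  assumes f: "f \<in> carrier thompson_T" and k: "k \<in> carrier thompson_T"
    and fix0: "f (inv_into UNIV k (circle_proj 0)) = inv_into UNIV k (circle_proj 0)"
  shows "f \<in> conjugate thompson_T thompson_F k"
proof -
  have bij: "bij k" using thompson_T_D(1)[OF k] by (rule circle_homeo_bij)
  define m where "m = k \<circ> f \<circ> inv_into UNIV k"
  have "m \<in> carrier thompson_T"
    unfolding m_def by (intro thompson_T_comp thompson_T_inv f k)
  moreover have "m (circle_proj 0) = circle_proj 0"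
    using fix0 bij by (simp add: m_def bij_is_surj surj_f_inv_f)
  ultimately have "m \<in> thompson_F" by (simp add: thompson_F_def)
  moreover have "f = inv_into UNIV k \<circ> m \<circ> k"
    using bij by (simp add: m_def fun_eq_iff bij_is_inj)
  ultimately show ?thesis
    unfolding conjugate_def l_coset_def r_coset_def inv_thompson_T[OF k] mult_thompson_T by blast
qed


section \<open>Elements of \<open>T\<close> with small support\<close>

definition dyadic_reals :: "real set" where
  "dyadic_reals = {of_int a / 2 powi k | (a::int) (k::int). True}"

lemma circle_dyadics_eq: "circle_dyadics = circle_proj ` dyadic_reals"
  by (auto simp: circle_dyadics_def dyadic_reals_def)

text \<open>A negative exponent \<open>k\<close> is absorbed into the numerator. Natural exponents
  make common denominators easy to form.\<close>

lemma dyadic_reals_iff: "x \<in> dyadic_reals \<longleftrightarrow> (\<exists>(a::int) (n::nat). x = of_int a / 2 ^ n)"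
proof
  assume "x \<in> dyadic_reals"
  then obtain a k :: int where x: "x = of_int a / 2 powi k" by (auto simp: dyadic_reals_def)
  show "\<exists>(a::int) (n::nat). x = of_int a / 2 ^ n"
  proof (cases "k \<ge> 0")
    case True
    then have "x = of_int a / 2 ^ nat k" by (simp add: x power_int_def)
    then show ?thesis by blast
  next
    case False
    then have "2 powi (- k) = (2 ^ nat (- k) :: real)" by (simp add: power_int_def)
    moreover have "x = of_int a * 2 powi (- k)" unfolding x by (simp only: power_int_minus divide_inverse)
    ultimately have "x = of_int (a * 2 ^ nat (- k)) / 2 ^ 0" by simp
    then show ?thesis by blast
  qed
next
  assume "\<exists>(a::int) (n::nat). x = of_int a / 2 ^ n"
  then obtain a :: int and n :: nat where "x = of_int a / 2 powi (int n)" by auto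
  then show "x \<in> dyadic_reals" unfolding dyadic_reals_def by blast
qed

lemma dyadic_reals_diff:
  assumes "x \<in> dyadic_reals" "y \<in> dyadic_reals" shows "x - y \<in> dyadic_reals"
proof -
  obtain a b :: int and m n :: nat where xy: "x = of_int a / 2 ^ m" "y = of_int b / 2 ^ n"
    using assms unfolding dyadic_reals_iff by blast
  have "x - y = of_int (a * 2 ^ n - b * 2 ^ m) / 2 ^ (m + n)"
    unfolding xy by (simp add: diff_divide_distrib power_add)
  then show ?thesis unfolding dyadic_reals_iff by blast
qed

lemma dyadic_reals_of_int: "of_int a \<in> dyadic_reals"
  unfolding dyadic_reals_iff by (intro exI[of _ a] exI[of _ 0]) simp

lemma dyadic_reals_add:
  assumes "x \<in> dyadic_reals" "y \<in> dyadic_reals" shows "x + y \<in> dyadic_reals"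
  using dyadic_reals_diff[OF assms(1) dyadic_reals_diff[OF dyadic_reals_of_int[of 0] assms(2)]] by simp

lemma dyadic_reals_double:
  assumes "x \<in> dyadic_reals" shows "2 * x \<in> dyadic_reals"
  using dyadic_reals_add[OF assms assms] by simp

lemma dyadic_reals_half:
  assumes "x \<in> dyadic_reals" shows "x / 2 \<in> dyadic_reals"
proof -
  obtain a :: int and n :: nat where "x = of_int a / 2 ^ n" using assms unfolding dyadic_reals_iff by blast
  then have "x / 2 = of_int a / 2 ^ Suc n" by simp
  then show ?thesis unfolding dyadic_reals_iff by blast
qed

section \<open>From interval maps to elements of T\<close>

definition periodize :: "(real \<Rightarrow> real) \<Rightarrow> real \<Rightarrow> real" where
  "periodize H x = of_int \<lfloor>x\<rfloor> + H (frac x)"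

text \<open>\<open>periodize H\<close> repeats the behaviour of \<open>H\<close> on the half-open
  unit interval over every integer translate. As \<open>H\<close> keeps that interval invariant, no
  translate is left.\<close>

lemma floor_frac_periodize:
  assumes "\<And>x. 0 \<le> x \<Longrightarrow> x < 1 \<Longrightarrow> 0 \<le> H x \<and> H x < 1"
  shows "\<lfloor>periodize H x\<rfloor> = \<lfloor>x\<rfloor>" "frac (periodize H x) = H (frac x)"
proof -
  have "0 \<le> H (frac x) \<and> H (frac x) < 1" using assms[of "frac x"] by (simp add: frac_lt_1)
  then show "\<lfloor>periodize H x\<rfloor> = \<lfloor>x\<rfloor>" by (simp add: periodize_def floor_unique)
  then show "frac (periodize H x) = H (frac x)" by (simp add: frac_def periodize_def)
qed

text \<open>Inside one unit interval the order comes from \<open>H\<close>; between different unit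
  intervals it comes from the preserved integer parts.\<close>

lemma strict_mono_periodize:
  assumes H: "\<And>x. 0 \<le> x \<Longrightarrow> x < 1 \<Longrightarrow> 0 \<le> H x \<and> H x < 1" and mono: "strict_mono H"
  shows "strict_mono (periodize H)"
proof (rule strict_monoI)
  fix x y :: real assume "x < y"
  show "periodize H x < periodize H y"
  proof (cases "\<lfloor>x\<rfloor> = \<lfloor>y\<rfloor>")
    case True
    then have "frac x < frac y" using \<open>x < y\<close> by (simp add: frac_def)
    then show ?thesis using True mono by (simp add: periodize_def strict_mono_def)
  next
    case False
    then have "\<lfloor>x\<rfloor> < \<lfloor>y\<rfloor>" using \<open>x < y\<close> floor_mono[of x y] by linarith
    moreover have "\<lfloor>periodize H z\<rfloor> = \<lfloor>z\<rfloor>" for z using H by (rule floor_frac_periodize(1))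
    ultimately show ?thesis by (metis floor_less_cancel)
  qed
qed

lemma periodize_inverse:
  assumes H: "\<And>x. 0 \<le> x \<Longrightarrow> x < 1 \<Longrightarrow> 0 \<le> H x \<and> H x < 1" and "\<And>x. G (H x) = x"
  shows "periodize G (periodize H x) = x"
  using floor_frac_periodize[of H x, OF H] assms(2) by (simp add: periodize_def[of G] frac_def)

definition circle_map :: "(real \<Rightarrow> real) \<Rightarrow> circle \<Rightarrow> circle" where
  "circle_map H p = circle_proj (periodize H (circle_rep p))"

text \<open>\<open>periodize H\<close> commutes with integer translations, so the representative
  picked by \<open>circle_rep\<close> does not affect the value on the circle.\<close>

lemma circle_map_proj: "circle_map H (circle_proj x) = circle_proj (periodize H x)"
proof -
  have "circle_proj (circle_rep (circle_proj x)) = circle_proj x"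
    by (rule Quotient_abs_rep[OF Quotient_circle])
  then obtain n where n: "circle_rep (circle_proj x) - x = of_int n"
    unfolding circle_proj_eq_iff by (elim Ints_cases)
  then have "circle_rep (circle_proj x) = x + of_int n" by simp
  then show ?thesis
    by (simp add: circle_map_def circle_proj_eq_iff periodize_def frac_def)
qed

lemma continuous_on_lift:
  assumes "continuous_on UNIV h" and "\<And>x. f (circle_proj x) = circle_proj (h x)"
  shows "continuous_on UNIV f"
proof -
  have "open (f -` U)" if "open U" for U
  proof -
    have "circle_proj -` f -` U = h -` circle_proj -` U" using assms(2) by auto
    moreover have "open (h -` circle_proj -` U)"
      using assms(1) that by (simp add: open_circle_def open_vimage)
    ultimately show ?thesis by (simp add: open_circle_def)
  qed
  then show ?thesis by (simp add: continuous_on_open_vimage)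
qed

text \<open>This reduces membership in T to conditions on a real map \<open>H\<close> and its
  inverse \<open>G\<close>. The point 0 is put into \<open>B\<close> because the two ends of the
  unit interval are glued there and the one-sided slopes may differ.\<close>

lemma circle_map_in_thompson_T:
  assumes H: "\<And>x. 0 \<le> x \<Longrightarrow> x < 1 \<Longrightarrow> 0 \<le> H x \<and> H x < 1" "strict_mono H"
    and G: "\<And>x. 0 \<le> x \<Longrightarrow> x < 1 \<Longrightarrow> 0 \<le> G x \<and> G x < 1"
    and GH: "\<And>x. G (H x) = x" and HG: "\<And>x. H (G x) = x"
    and dyadic: "\<And>x. x \<in> dyadic_reals \<Longrightarrow> H x \<in> dyadic_reals" "\<And>x. x \<in> dyadic_reals \<Longrightarrow> G x \<in> dyadic_reals"
    and B: "finite B" "0 \<in> B" "B \<subseteq> dyadic_reals"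
    and aff: "\<And>x. 0 < x \<Longrightarrow> x < 1 \<Longrightarrow> x \<notin> B \<Longrightarrow>
      \<exists>(k::int) c S. open S \<and> x \<in> S \<and> (\<forall>y\<in>S. H y = 2 powi k * y + c)"
  shows "circle_map H \<in> carrier thompson_T"
proof (rule thompson_T_I[where B="circle_proj ` B"])
  have monoG: "strict_mono G" 
  proof (rule strict_monoI)
    fix x y :: real assume "x < y"
    then have "H (G x) < H (G y)" by (simp add: HG)
    then show "G x < G y" using H(2) by (simp add: strict_mono_less)
  qed
  have inv: "periodize G (periodize H x) = x" "periodize H (periodize G x) = x" for x
    using periodize_inverse[of H G, OF H(1) GH] periodize_inverse[of G H, OF G HG] by simp_all
  have mono: "strict_mono (periodize H)" "strict_mono (periodize G)"
    using strict_mono_periodize[of H, OF H] strict_mono_periodize[of G, OF G monoG] by simp_all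
  \<comment> \<open>Both maps are monotone, and as mutual inverses both are onto the line; this
    forces continuity.\<close>
  have cont: "continuous_on UNIV (periodize H)" "continuous_on UNIV (periodize G)"
    using mono surjI[of "periodize H" "periodize G", OF inv(2)] surjI[of "periodize G" "periodize H", OF inv(1)]
    by (simp_all add: continuous_onI_mono strict_mono_less_eq)
  have inv_map: "circle_map G (circle_map H p) = p" "circle_map H (circle_map G p) = p" for p
    using inv circle_proj_surj[of p] by (auto simp: circle_map_proj)
  have "homeomorphism UNIV UNIV (circle_map H) (circle_map G)"
    using continuous_on_lift[OF cont(1) circle_map_proj] continuous_on_lift[OF cont(2) circle_map_proj]
    by (rule homeomorphismI) (simp_all add: inv_map)
  then show "circle_homeo (circle_map H)" unfolding circle_homeo_def by blast
  show "orientation_preserving (circle_map H)"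
    unfolding orientation_preserving_def
    using cont(1) mono(1) by (intro exI[of _ "periodize H"]) (simp add: circle_map_proj)
  \<comment> \<open>Stated for a general \<open>K\<close> so that it applies to \<open>H\<close> and
    to \<open>G\<close>, which yields the two inclusions of the next equality.\<close>
  have sub: "circle_map K ` circle_dyadics \<subseteq> circle_dyadics"
    if "\<And>x. x \<in> dyadic_reals \<Longrightarrow> K x \<in> dyadic_reals" for K
    unfolding circle_dyadics_eq
    by (auto simp: circle_map_proj periodize_def frac_def
        intro!: imageI dyadic_reals_add dyadic_reals_diff dyadic_reals_of_int that)
  show "circle_map H ` circle_dyadics = circle_dyadics"
  proof
    show "circle_map H ` circle_dyadics \<subseteq> circle_dyadics" using sub dyadic by blast
    show "circle_dyadics \<subseteq> circle_map H ` circle_dyadics"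
    proof
      fix p assume "p \<in> circle_dyadics"
      then have "circle_map G p \<in> circle_dyadics" using sub[of G] dyadic by blast
      then show "p \<in> circle_map H ` circle_dyadics" using inv_map(2)[of p] by (metis imageI)
    qed
  qed
  show "finite (circle_proj ` B)" using B by simp
  show "circle_proj ` B \<subseteq> circle_dyadics" using B circle_dyadics_eq by auto
  show "\<exists>k::int. locally_affine_at (circle_map H) p (2 powi k)" if p: "p \<notin> circle_proj ` B" for p
  proof -
    obtain x' where x': "p = circle_proj x'" using circle_proj_surj by metis
    define x where "x = frac x'"
    have x: "p = circle_proj x" by (simp add: x' x_def circle_proj_eq_iff frac_def)
    have "x \<notin> B" using p x by auto
    then have "x \<noteq> 0" using B(2) by metis
    then have x01: "0 < x" "x < 1"
      using frac_ge_0[of x'] frac_lt_1[of x'] unfolding x_def by linarith+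
    then obtain k :: int and c S where S: "open S" "x \<in> S" "\<And>y. y \<in> S \<Longrightarrow> H y = 2 powi k * y + c"
      using aff[OF x01 \<open>x \<notin> B\<close>] by blast
    \<comment> \<open>Inside the open unit interval the integer part is 0, so
      \<open>periodize H\<close> coincides with \<open>H\<close> there.\<close>
    have "open (S \<inter> {0<..<1})" "x \<in> S \<inter> {0<..<1}" using S(1,2) x01 by auto
    then obtain e where e: "e > 0" and ball: "\<And>y. dist y x < e \<Longrightarrow> y \<in> S \<inter> {0<..<1}"
      unfolding open_dist by metis
    have "circle_map H (circle_proj (x + t)) = circle_proj (H x + 2 powi k * t)" if "\<bar>t\<bar> < e" for t
    proof -
      have t: "x + t \<in> S" "0 < x + t" "x + t < 1" using ball[of "x + t"] that by (auto simp: dist_real_def)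
      then have "periodize H (x + t) = H (x + t)"
        by (simp add: periodize_def frac_eq floor_eq_iff)
      then show ?thesis using S t by (simp add: circle_map_proj algebra_simps)
    qed
    then have "locally_affine_at (circle_map H) p (2 powi k)"
      using e x unfolding locally_affine_at_def by metis
    then show ?thesis by blast
  qed
qed

section \<open>A rescaled generator of F\<close>

text \<open>The generator of \<open>F\<close> with slopes \<open>2\<close>, \<open>1\<close>, \<open>1/2\<close> and breaks \<open>0, 1/4, 1/2, 1\<close>, rescaled from
  \<open>[0, 1]\<close> to \<open>[0, 4d]\<close>; it is concave there, hence the minimum of its affine pieces.\<close>

definition bump :: "real \<Rightarrow> real \<Rightarrow> real" where
  "bump d x = max x (min (2 * x) (min (x + d) (x / 2 + 2 * d)))"

text \<open>Each affine piece of \<open>bump d\<close> is inverted, and \<open>max\<close> and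
  \<open>min\<close> are exchanged, as happens when increasing maps are inverted.\<close>

definition bump_inv :: "real \<Rightarrow> real \<Rightarrow> real" where
  "bump_inv d y = min y (max (y / 2) (max (y - d) (2 * y - 4 * d)))"

lemma bump_inverse:
  assumes "0 < d"
  shows "bump_inv d (bump d x) = x" "bump d (bump_inv d x) = x"
proof -
  \<comment> \<open>The cases follow the breaks 0, \<open>d\<close>, \<open>2 * d\<close>,
    \<open>4 * d\<close> of \<open>bump d\<close>. The second half of the proof uses their images 0,
    \<open>2 * d\<close>, \<open>3 * d\<close>, \<open>4 * d\<close>.\<close>
  consider "x \<le> 0" | "0 \<le> x" "x \<le> d" | "d \<le> x" "x \<le> 2 * d" | "2 * d \<le> x" "x \<le> 4 * d" | "4 * d \<le> x"
    by linarith
  then show "bump_inv d (bump d x) = x"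
  proof cases
    case 1
    then have "bump d x = x" using assms by (simp add: bump_def)
    then show ?thesis using 1 assms by (simp add: bump_inv_def)
  next
    case 2
    then have "bump d x = 2 * x" using assms by (simp add: bump_def)
    then show ?thesis using 2 assms by (simp add: bump_inv_def)
  next
    case 3
    then have "bump d x = x + d" using assms by (simp add: bump_def)
    then show ?thesis using 3 assms by (simp add: bump_inv_def)
  next
    case 4
    then have "bump d x = x / 2 + 2 * d" using assms by (simp add: bump_def)
    then show ?thesis using 4 assms by (simp add: bump_inv_def)
  next
    case 5
    then have "bump d x = x" using assms by (simp add: bump_def)
    then show ?thesis using 5 assms by (simp add: bump_inv_def)
  qed
  consider "x \<le> 0" | "0 \<le> x" "x \<le> 2 * d" | "2 * d \<le> x" "x \<le> 3 * d" | "3 * d \<le> x" "x \<le> 4 * d" | "4 * d \<le> x"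
    by linarith
  then show "bump d (bump_inv d x) = x"
  proof cases
    case 1
    then have "bump_inv d x = x" using assms by (simp add: bump_inv_def)
    then show ?thesis using 1 assms by (simp add: bump_def)
  next
    case 2
    then have "bump_inv d x = x / 2" using assms by (simp add: bump_inv_def)
    then show ?thesis using 2 assms by (simp add: bump_def)
  next
    case 3
    then have "bump_inv d x = x - d" using assms by (simp add: bump_inv_def)
    then show ?thesis using 3 assms unfolding bump_def by linarith
  next
    case 4
    then have "bump_inv d x = 2 * x - 4 * d" using assms by (simp add: bump_inv_def)
    then show ?thesis using 4 assms unfolding bump_def by linarith
  next
    case 5
    then have "bump_inv d x = x" using assms by (simp add: bump_inv_def)
    then show ?thesis using 5 assms by (simp add: bump_def)
  qed
qed

text \<open>The exponents 1, 0, -1, 0 on successive pieces are those of the slopes 2, 1, 1/2, 1, the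
  last belonging to the identity right of \<open>4 * d\<close>. Since \<open>4 * d < 1\<close>, the
  unit interval is preserved.\<close>

lemma bump_in_thompson_T:
  assumes d: "d \<in> dyadic_reals" "0 < d" "4 * d < 1"
  shows "circle_map (bump d) \<in> carrier thompson_T"
proof (rule circle_map_in_thompson_T[where G="bump_inv d" and B="{0, d, 2 * d, 4 * d}"])
  show "0 \<le> bump d x \<and> bump d x < 1" if "0 \<le> x" "x < 1" for x
    using that d by (auto simp: bump_def max_def min_def)
  show "0 \<le> bump_inv d x \<and> bump_inv d x < 1" if "0 \<le> x" "x < 1" for x
    using that d by (auto simp: bump_inv_def max_def min_def)
  show "strict_mono (bump d)" by (rule strict_monoI) (auto simp: bump_def max_def min_def)
  show "bump_inv d (bump d x) = x" "bump d (bump_inv d x) = x" for x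
    using d(2) by (rule bump_inverse)+
  note closed = dyadic_reals_add dyadic_reals_diff dyadic_reals_double dyadic_reals_half
  have d4: "4 * d \<in> dyadic_reals" using closed(3)[OF closed(3)[OF d(1)]] by simp
  show "bump d x \<in> dyadic_reals" if "x \<in> dyadic_reals" for x
    using that d(1) by (auto simp: bump_def max_def min_def intro!: closed)
  show "bump_inv d x \<in> dyadic_reals" if "x \<in> dyadic_reals" for x
    using that d(1) d4 by (auto simp: bump_inv_def max_def min_def intro!: closed)
  show "{0, d, 2 * d, 4 * d} \<subseteq> dyadic_reals"
    using d(1) d4 dyadic_reals_of_int[of 0] by (auto intro: closed)
  show "\<exists>(k::int) c S. open S \<and> x \<in> S \<and> (\<forall>y\<in>S. bump d y = 2 powi k * y + c)"
    if x: "0 < x" "x < 1" "x \<notin> {0, d, 2 * d, 4 * d}" for x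
  proof -
    consider "0 < x" "x < d" | "d < x" "x < 2 * d" | "2 * d < x" "x < 4 * d" | "4 * d < x"
      using x by (metis insertCI linorder_neqE_linordered_idom)
    then show ?thesis
    proof cases
      case 1
      then show ?thesis
        by (intro exI[of _ 1] exI[of _ 0] exI[of _ "{0<..<d}"]) (auto simp: bump_def max_def min_def)
    next
      case 2
      then show ?thesis
        by (intro exI[of _ 0] exI[of _ d] exI[of _ "{d<..<2 * d}"]) (auto simp: bump_def max_def min_def)
    next
      case 3
      then show ?thesis
        by (intro exI[of _ "-1"] exI[of _ "2 * d"] exI[of _ "{2 * d<..<4 * d}"])
          (auto simp: bump_def max_def min_def power_int_minus)
    next
      case 4
      then show ?thesis using d
        by (intro exI[of _ 0] exI[of _ 0] exI[of _ "{4 * d<..}"]) (auto simp: bump_def max_def min_def)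
    qed
  qed
qed auto

lemma thompson_T_fixing_finite_set:
  assumes "finite P"
  shows "\<exists>f\<in>carrier thompson_T. f \<noteq> id \<and> (\<forall>p\<in>P. f p = p)"
proof -
  \<comment> \<open>The circle point 0 is discarded because \<open>bump d\<close> fixes it for every
    \<open>d\<close>. Inserting 1 makes the set nonempty and bounds its minimum by 1.\<close>
  define X where "X = insert 1 ((\<lambda>p. frac (circle_rep p)) ` P - {0})"
  have X: "finite X" "X \<noteq> {}" using assms by (auto simp: X_def)
  have "0 < Min X"
    using X by (subst Min_gr_iff) (auto simp: X_def less_le)
  then obtain n where n: "(1 / 2) ^ n < Min X" using real_arch_pow_inv[of "Min X" "1 / 2"] by auto
  \<comment> \<open>The bump moves only points between 0 and \<open>4 * d = (1 / 2) ^ n\<close>,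
    which lies below every element of \<open>X\<close>.\<close>
  define d :: real where "d = (1 / 2) ^ n / 4"
  have "d = of_int 1 / 2 ^ (n + 2)" by (simp add: d_def power_add power_divide)
  then have dy: "d \<in> dyadic_reals" unfolding dyadic_reals_iff by blast
  have d: "0 < d" "4 * d < Min X" using n by (auto simp: d_def)
  have d1: "4 * d < 1" using d(2) X by (auto simp: X_def)
  have "circle_map (bump d) p = p" if "p \<in> P" for p
  proof -
    have "frac (circle_rep p) = 0 \<or> 4 * d < frac (circle_rep p)"
      using that d(2) X by (auto simp: X_def)
    then have "bump d (frac (circle_rep p)) = frac (circle_rep p)"
      unfolding bump_def using d by linarith
    then have "periodize (bump d) (circle_rep p) = circle_rep p" by (simp add: periodize_def frac_def)
    then show ?thesis using Quotient_abs_rep[OF Quotient_circle] by (simp add: circle_map_def)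
  qed
  \<comment> \<open>The point \<open>d\<close> witnesses this: it is sent to \<open>2 * d\<close>,
    and the displacement \<open>d\<close> lies strictly between 0 and 1, so it is not an
    integer.\<close>
  moreover have "circle_map (bump d) \<noteq> id"
  proof
    assume "circle_map (bump d) = id"
    moreover have "\<lfloor>d\<rfloor> = 0" "frac d = d" using d d1 by (auto simp: floor_eq_iff frac_eq)
    ultimately have "circle_proj (2 * d) = circle_proj d"
      using d circle_map_proj[of "bump d" d] by (simp add: periodize_def bump_def)
    then have "d \<in> \<int>" by (simp add: circle_proj_eq_iff)
    then show False using d d1 Ints_nonzero_abs_less1[of d] by auto
  qed
  ultimately show ?thesis using bump_in_thompson_T[OF dy d(1) d1] by blast
qed

theorem mainTheorem2: "normalish thompson_F thompson_T"
  unfolding normalish_def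
proof (intro conjI allI impI)
  fix K assume K: "finite K \<and> K \<noteq> {} \<and> K \<subseteq> carrier thompson_T"
  then obtain f where f: "f \<in> carrier thompson_T" "f \<noteq> id"
    and fixes_pts: "\<forall>p\<in>(\<lambda>k. inv_into UNIV k (circle_proj 0)) ` K. f p = p"
    using thompson_T_fixing_finite_set[of "(\<lambda>k. inv_into UNIV k (circle_proj 0)) ` K"] by auto
  then have "f \<in> (\<Inter>k\<in>K. conjugate thompson_T thompson_F k)"
    using K by (auto intro!: mem_conjugate_thompson_F)
  then show "(\<Inter>k\<in>K. conjugate thompson_T thompson_F k) \<noteq> {\<one>\<^bsub>thompson_T\<^esub>}"
    using f(2) by auto
qed (rule group_thompson_T subgroup_thompson_F)+

end
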